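(* Let $k\ge 1$ be an integer, let $M,N$ be non-negative integers, and let $a_j,b_j,x_j,y_j,z_j$ ($1\le j\le k$) be complex numbers. Then \[ H_{M,N}\bigl(a_1x_1+\cdots+a_kx_k,\; b_1y_1+\cdots+b_ky_k,\; a_1b_1z_1+\cdots+a_kb_kz_k\bigr) \] \[ =\sum_{m_1,n_1,\ldots,m_k,n_k}\frac{M!\,N!}{m_1!\,n_1!\cdots m_k!\,n_k!}\,a_1^{m_1}\cdots a_k^{m_k}\,b_1^{n_1}\cdots b_k^{n_k}\,H_{m_1,n_1}(x_1,y_1,z_1)\cdots H_{m_k,n_k}(x_k,y_k,z_k), \] where the sum is taken over all non-negative integers $m_1,\ldots,m_k$ and $n_1,\ldots,n_k$ such that $m_1+\cdots+m_k=M$ and $n_1+\cdots+n_k=N$.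
   Context: For complex numbers $x,y,z$ and non-negative integers $m,n$, the (three-variable) complex Hermite polynomials are defined by \[ H_{m,n}(x,y,z)=\sum_{k=0}^{\min\{m,n\}} k!\binom{m}{k}\binom{n}{k}x^{m-k}y^{n-k}z^k . \] *)

theory Defs
  imports Complex_Main "HOL-Library.FuncSet"
begin

definition hermite :: "nat \<Rightarrow> nat \<Rightarrow> complex \<Rightarrow> complex \<Rightarrow> complex \<Rightarrow> complex" where
  "hermite m n x y z =
     (\<Sum>k = 0..min m n. fact k * of_nat (m choose k) * of_nat (n choose k)
        * x ^ (m - k) * y ^ (n - k) * z ^ k)"

text \<open>The tuples $(m_1, \ldots, m_k)$ of non-negative integers with sum $M$ are encoded as
  functions on $\{1, \ldots, k\}$, extensional so that each tuple is counted exactly once.\<close>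

definition weak_compositions :: "nat \<Rightarrow> nat \<Rightarrow> (nat \<Rightarrow> nat) set" where
  "weak_compositions k M = {m \<in> {1..k} \<rightarrow>\<^sub>E UNIV. (\<Sum>j = 1..k. m j) = M}"

text \<open>Finiteness ensures that sums over these tuples are genuine.\<close>

lemma finite_weak_compositions: "finite (weak_compositions k M)"
proof (rule finite_subset)
  show "weak_compositions k M \<subseteq> {1..k} \<rightarrow>\<^sub>E {..M}"
  proof
    fix m assume "m \<in> weak_compositions k M"
    then have ext: "m \<in> {1..k} \<rightarrow>\<^sub>E UNIV" and s: "(\<Sum>j = 1..k. m j) = M"
      by (auto simp: weak_compositions_def)
    have "m j \<le> M" if "j \<in> {1..k}" for j
      using member_le_sum[of j "{1..k}" m] that s by simp
    with ext show "m \<in> {1..k} \<rightarrow>\<^sub>E {..M}"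
      by (auto simp: PiE_iff)
  qed
  show "finite ({1..k} \<rightarrow>\<^sub>E {..M})"
    by (intro finite_PiE) auto
qed

end

theory Submission
  imports Defs "HOL-Computational_Algebra.Formal_Power_Series"
begin

unbundle fps_syntax

text \<open>Generating functions: \<open>H\<^sub>m\<^sub>,\<^sub>n(x,y,z) / (m! n!)\<close> is the coefficient of \<open>u\<^sup>m v\<^sup>n\<close> in
  \<open>exp (x u + y v + z u v)\<close>, which is multiplicative in \<open>(x,y,z)\<close>, and
  \<open>a\<^sup>m b\<^sup>n H\<^sub>m\<^sub>,\<^sub>n(x,y,z) = H\<^sub>m\<^sub>,\<^sub>n(a x, b y, a b z)\<close>.\<close>

lemma weak_compositions_0: "weak_compositions 0 M = (if M = 0 then {\<lambda>_. undefined} else {})"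
  by (auto simp: weak_compositions_def)

text \<open>Splits off the last entry: \<open>i\<close> is the sum of the first \<open>k\<close>
  entries, so the last one must be \<open>M - i\<close>. This is the shape of a Cauchy product
  coefficient.\<close>

lemma sum_weak_compositions_Suc:
  fixes f :: "(nat \<Rightarrow> nat) \<Rightarrow> 'a :: comm_monoid_add"
  shows "(\<Sum>m \<in> weak_compositions (Suc k) M. f m)
    = (\<Sum>i = 0..M. \<Sum>m \<in> weak_compositions k i. f (m(Suc k := M - i)))"
proof -
  have "(\<Sum>i = 0..M. \<Sum>m \<in> weak_compositions k i. f (m(Suc k := M - i)))
      = (\<Sum>(i, m) \<in> Sigma {0..M} (weak_compositions k). f (m(Suc k := M - i)))"
    by (rule sum.Sigma) (auto simp: finite_weak_compositions)
  also have "\<dots> = (\<Sum>m \<in> weak_compositions (Suc k) M. f m)"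
  proof (rule sum.reindex_bij_witness
      [where j = "\<lambda>(i, m). m(Suc k := M - i)"
         and i = "\<lambda>m. (M - m (Suc k), m(Suc k := undefined))"])
    fix p assume "p \<in> Sigma {0..M} (weak_compositions k)"
    then obtain i m where p: "p = (i, m)" and i: "i \<le> M"
      and m: "m \<in> {1..k} \<rightarrow>\<^sub>E UNIV" and s: "(\<Sum>j = 1..k. m j) = i"
      by (auto simp: weak_compositions_def)
    \<comment> \<open>Extensionality on \<open>{1..k}\<close> already forces the value
      \<open>undefined\<close> at \<open>Suc k\<close>; hence resetting that entry undoes the
      extension.\<close>
    have u: "m(Suc k := undefined) = m"
      using m by (auto simp: PiE_iff extensional_def fun_eq_iff)
    have s': "(\<Sum>j = 1..k. (m(Suc k := c)) j) = i" for c
      unfolding s[symmetric] by (rule sum.cong) auto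
    show "(\<lambda>m. (M - m (Suc k), m(Suc k := undefined))) ((\<lambda>(i, m). m(Suc k := M - i)) p) = p"
      using i u by (simp add: p)
    show "(\<lambda>(i, m). m(Suc k := M - i)) p \<in> weak_compositions (Suc k) M"
      using m i s' by (auto simp: p weak_compositions_def PiE_iff extensional_def)
    show "f ((\<lambda>(i, m). m(Suc k := M - i)) p) = (case p of (i, m) \<Rightarrow> f (m(Suc k := M - i)))"
      by (simp add: p)
  next
    fix m assume "m \<in> weak_compositions (Suc k) M"
    then have m: "m \<in> {1..Suc k} \<rightarrow>\<^sub>E UNIV" and s: "(\<Sum>j = 1..k. m j) + m (Suc k) = M"
      by (auto simp: weak_compositions_def)
    have s': "(\<Sum>j = 1..k. (m(Suc k := c)) j) = (\<Sum>j = 1..k. m j)" for c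
      by (rule sum.cong) auto
    show "(\<lambda>(i, m). m(Suc k := M - i)) (M - m (Suc k), m(Suc k := undefined)) = m"
      using s by auto
    show "(M - m (Suc k), m(Suc k := undefined)) \<in> Sigma {0..M} (weak_compositions k)"
      using m s s' by (auto simp: weak_compositions_def PiE_iff extensional_def)
  qed
  finally show ?thesis by simp
qed

text \<open>Iterated Cauchy product. The general coefficient ring allows its use both for series in
  \<open>v\<close> and for their coefficients, which are series in \<open>u\<close>.\<close>

lemma fps_nth_prod_weak_compositions:
  fixes g :: "nat \<Rightarrow> 'a :: comm_ring_1 fps"
  shows "(\<Prod>j = 1..k. g j) $ M = (\<Sum>m \<in> weak_compositions k M. \<Prod>j = 1..k. g j $ m j)"
proof (induction k arbitrary: M)
  case 0
  show ?case by (simp add: weak_compositions_0)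
next
  case (Suc k)
  have eq: "(\<Prod>j = 1..k. g j $ (m(Suc k := c)) j) = (\<Prod>j = 1..k. g j $ m j)" for m c
    by (rule prod.cong) auto
  show ?case
    by (simp add: sum_weak_compositions_Suc fps_mult_nth Suc.IH sum_distrib_right eq del: One_nat_def)
qed

text \<open>The series \<open>exp (x u + y v + z u v)\<close>, in \<open>v\<close> with coefficients in \<open>u\<close>.\<close>

definition hermite_gf :: "complex \<Rightarrow> complex \<Rightarrow> complex \<Rightarrow> complex fps fps" where
  "hermite_gf x y z =
     Abs_fps (\<lambda>n. fps_const (1 / fact n) * (fps_exp x * (fps_const z * fps_X + fps_const y) ^ n))"

lemma hermite_gf_0: "hermite_gf 0 0 0 = 1"
  by (rule fps_ext) (simp add: hermite_gf_def)

text \<open>The law exp(s + t) = exp(s) exp(t), checked on the coefficient of \<open>v^n\<close>: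
  the factor in \<open>u\<close> alone splits directly, and the power of \<open>p + p'\<close> by
  the binomial theorem.\<close>

lemma hermite_gf_add:
  "hermite_gf (x + x') (y + y') (z + z') = hermite_gf x y z * hermite_gf x' y' z'"
proof (rule fps_ext)
  fix n
  define p where "p = fps_const z * fps_X + fps_const y"
  define p' where "p' = fps_const z' * fps_X + fps_const y'"
  have "hermite_gf (x + x') (y + y') (z + z') $ n
      = fps_const (1 / fact n) * (fps_exp x * fps_exp x' * (p + p') ^ n)"
    by (simp add: hermite_gf_def p_def p'_def fps_exp_add_mult algebra_simps
        flip: fps_const_add)
  also have "\<dots> = (\<Sum>i = 0..n. (fps_const (1 / fact n) * of_nat (n choose i))
      * (fps_exp x * fps_exp x' * p ^ i * p' ^ (n - i)))"
    by (simp add: binomial_ring sum_distrib_left atMost_atLeast0 mult_ac)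
  also have "\<dots> = (\<Sum>i = 0..n. (fps_const (1 / fact i) * fps_const (1 / fact (n - i)))
      * (fps_exp x * fps_exp x' * p ^ i * p' ^ (n - i)))"
  proof (rule sum.cong)
    fix i assume "i \<in> {0..n}"
    \<comment> \<open>Dividing the binomial coefficient by \<open>n!\<close> leaves
      \<open>1 / (i! (n - i)!)\<close>, which separates the two factors of the Cauchy product in
      \<open>v\<close>.\<close>
    then have "fps_const (1 / fact n) * of_nat (n choose i)
        = (fps_const (1 / fact i) * fps_const (1 / fact (n - i)) :: complex fps)"
      by (simp add: binomial_fact flip: fps_of_nat)
    then show "fps_const (1 / fact n) * of_nat (n choose i)
        * (fps_exp x * fps_exp x' * p ^ i * p' ^ (n - i))
      = fps_const (1 / fact i) * fps_const (1 / fact (n - i))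
        * (fps_exp x * fps_exp x' * p ^ i * p' ^ (n - i))"
      by (rule arg_cong)
  qed simp
  also have "\<dots> = (hermite_gf x y z * hermite_gf x' y' z') $ n"
    by (simp add: fps_mult_nth hermite_gf_def p_def p'_def mult_ac del: fps_const_mult)
  finally show "hermite_gf (x + x') (y + y') (z + z') $ n
    = (hermite_gf x y z * hermite_gf x' y' z') $ n" .
qed

text \<open>For infinite \<open>A\<close> the sums default to 0 and the product to 1, so
  \<open>hermite_gf_0\<close> settles this case as well as the empty one.\<close>

lemma hermite_gf_sum:
  "hermite_gf (\<Sum>j\<in>A. x j) (\<Sum>j\<in>A. y j) (\<Sum>j\<in>A. z j) = (\<Prod>j\<in>A. hermite_gf (x j) (y j) (z j))"
  by (induction A rule: infinite_finite_induct) (simp_all add: hermite_gf_0 hermite_gf_add)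

text \<open>To form \<open>u^m\<close>, take \<open>u^i\<close> from the expanded power of
  \<open>z u + y\<close> and \<open>u^(m - i)\<close> from \<open>exp (x u)\<close>; this
  \<open>i\<close> is the summation index of \<open>hermite\<close>.\<close>

lemma hermite_gf_nth: "hermite_gf x y z $ n $ m = hermite m n x y z / (fact m * fact n)"
proof -
  have "(fps_const z * fps_X + fps_const y) ^ n
      = (\<Sum>i\<le>n. fps_const (of_nat (n choose i) * z ^ i * y ^ (n - i)) * fps_X ^ i)"
    by (simp add: binomial_ring power_mult_distrib fps_const_power mult_ac
        flip: fps_of_nat fps_const_mult)
  then have "hermite_gf x y z $ n
      = (\<Sum>i\<le>n. fps_const (1 / fact n * (of_nat (n choose i) * z ^ i * y ^ (n - i)))
          * (fps_exp x * fps_X ^ i))"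
    by (simp add: hermite_gf_def sum_distrib_left mult_ac)
  then have "hermite_gf x y z $ n $ m
      = (\<Sum>i\<le>n. if i \<le> m then 1 / fact n * (of_nat (n choose i) * z ^ i * y ^ (n - i)
          * (x ^ (m - i) / fact (m - i))) else 0)"
    by (auto simp: fps_sum_nth fps_X_power_mult_right_nth intro!: sum.cong)
  also have "\<dots> = (\<Sum>i = 0..min m n. 1 / fact n * (of_nat (n choose i) * z ^ i * y ^ (n - i)
          * (x ^ (m - i) / fact (m - i))))"
    by (rule sum.mono_neutral_cong_right) auto
  also have "\<dots> = hermite m n x y z / (fact m * fact n)"
    unfolding hermite_def sum_divide_distrib
    \<comment> \<open>Only \<open>m choose i\<close> is expanded, through
      \<open>i! (m choose i) / m! = 1 / (m - i)!\<close>; \<open>n choose i\<close> occurs on both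
      sides.\<close>
    by (rule sum.cong) (auto simp: binomial_fact[of _ m] field_simps)
  finally show ?thesis .
qed

lemma hermite_scale: "hermite m n (a * x) (b * y) (a * b * z) = a ^ m * b ^ n * hermite m n x y z"
  unfolding hermite_def sum_distrib_left
proof (rule sum.cong)
  fix i assume "i \<in> {0..min m n}"
  \<comment> \<open>Since \<open>i \<le> min m n\<close>, the truncated subtractions are exact, and
    every term carries the same total factor \<open>a^m b^n\<close>.\<close>
  then have "a ^ m = a ^ (m - i) * a ^ i" "b ^ n = b ^ (n - i) * b ^ i"
    by (simp_all flip: power_add)
  then show "fact i * of_nat (m choose i) * of_nat (n choose i)
      * (a * x) ^ (m - i) * (b * y) ^ (n - i) * (a * b * z) ^ i
    = a ^ m * b ^ n * (fact i * of_nat (m choose i) * of_nat (n choose i)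
      * x ^ (m - i) * y ^ (n - i) * z ^ i)"
    by (simp add: power_mult_distrib mult_ac)
qed simp

theorem theorem5p1:
  fixes k M N :: nat and a b x y z :: "nat \<Rightarrow> complex"
  assumes "k \<ge> 1"
  shows "hermite M N (\<Sum>j = 1..k. a j * x j) (\<Sum>j = 1..k. b j * y j) (\<Sum>j = 1..k. a j * b j * z j)
    = (\<Sum>(m, n) \<in> weak_compositions k M \<times> weak_compositions k N.
         fact M * fact N / (\<Prod>j = 1..k. fact (m j) * fact (n j))
         * (\<Prod>j = 1..k. a j ^ m j) * (\<Prod>j = 1..k. b j ^ n j)
         * (\<Prod>j = 1..k. hermite (m j) (n j) (x j) (y j) (z j)))"
    (is "?H = _")
proof -
  let ?g = "\<lambda>j. hermite_gf (a j * x j) (b j * y j) (a j * b j * z j)"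
  have "?H = fact M * fact N * (\<Prod>j = 1..k. ?g j) $ N $ M"
    by (simp add: hermite_gf_nth flip: hermite_gf_sum)
  \<comment> \<open>The product formula is applied twice: the coefficient of \<open>v^N\<close>
    distributes \<open>N\<close> over the factors, then that of \<open>u^M\<close> distributes
    \<open>M\<close>.\<close>
  also have "(\<Prod>j = 1..k. ?g j) $ N $ M
      = (\<Sum>n \<in> weak_compositions k N. \<Sum>m \<in> weak_compositions k M. \<Prod>j = 1..k. ?g j $ n j $ m j)"
    by (simp add: fps_nth_prod_weak_compositions fps_sum_nth del: One_nat_def)
  also have "\<dots> = (\<Sum>(m, n) \<in> weak_compositions k M \<times> weak_compositions k N.
      \<Prod>j = 1..k. ?g j $ n j $ m j)"
    by (subst sum.swap) (simp add: sum.cartesian_product)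
  finally show ?thesis
    \<comment> \<open>Each factor is read back as a scaled Hermite value over
      \<open>m_j! n_j!\<close>, and scaling releases the powers of \<open>a j\<close> and
      \<open>b j\<close>.\<close>
    by (simp only: hermite_gf_nth hermite_scale prod_dividef prod.distrib)
      (simp add: sum_distrib_left case_prod_unfold mult_ac)
qed

end
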